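(* Let $n,c,r\in\mathbb{N}$, $q\in(0,1)$, $\phi(q)=-\log(1-q)$, let $Y_1^{(c)},\ldots,Y_n^{(c)}$ be i.i.d. $\mathrm{NegBin}(c,q)$, and $Y_{n:n}^{(c)}=\max_j Y_j^{(c)}$. Let $\tilde Y^{(c)}\sim\mathrm{Gamma}(c,1)$ and $Q(c,x)=\Gamma(c,x)/\Gamma(c)=\mathbb{P}(\tilde Y^{(c)}>x)$. Then the $r$-th moment of $Y_{n:n}^{(c)}$ has lower and upper bounds $$\mathbb{E}\bigl[(Y_{n:n}^{(c)})^r\bigr]\ \ge\ \frac{1}{\phi(q)^{r}}\,l(t,n,c,r),\qquad \mathbb{E}\bigl[(Y_{n:n}^{(c)})^r\bigr]\ \le\ \sum_{p=0}^{r}\binom{r}{p}\frac{1}{\phi(q)^{p}}\,u(s,n,c,p)\,c^{r-p},$$ where $$l(t,n,c,r)=t^r-\bigl(t^r-\mathbb{E}[(\tilde Y^{(c)})^r]\bigr)\bigl(1-Q(c,t)\bigr)^{n-1},$$ $$u(s,n,c,r)=s+n\Bigl(\Bigl(\tfrac{\Gamma(c+r)}{\Gamma(c)}-s\Bigr)Q(c,s^{1/r})+\tfrac{\Gamma(c+r)}{\Gamma(c)}\,s^{\frac{c+r-1}{r}}e^{-s^{1/r}}\sum_{m=0}^{r-1}\frac{1}{s^{m/r}\,\Gamma(c+r-m)}\Bigr).$$ For the lower bound, $t\ge\bigl(\mathbb{E}[(\tilde Y^{(c)})^r]\bigr)^{1/r}$; it is made the tightest by solving for the unique stationary point $t^*$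 such that $\frac{\partial}{\partial t}l(t,n,c,r)=0$. For the upper bound, $s\ge0$, and the optimal $s^*$ is such that $n\,Q\bigl(c,(s^* )^{1/r}\bigr)=1$. For $r=1$, the optimal upper bound is $$\mathbb{E}[Y_{n:n}^{(c)}]\le c\Bigl(1+\frac{1}{\phi(q)}\,n\,Q\bigl(c+1,Q^{-1}(c,\tfrac1n)\bigr)\Bigr).$$
   Context: $\mathbb{N}=\{1,2,\ldots\}$. $\mathrm{NegBin}(c,q)$ is the law of the sum of $c$ independent geometric random variables on $\{1,2,\ldots\}$ with success probability $q$. $\mathrm{Gamma}(c,1)$ is the law of the sum of $c$ independent unit-rate exponential random variables; $\Gamma(c,x)=\int_x^\infty t^{c-1}e^{-t}\,dt$ is the upper incomplete Gamma function. $Q^{-1}(c,\cdot)$ is the inverse of $x\mapsto Q(c,x)$.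
   Formalization: Uniqueness of t* is claimed only for n ≥ 2 (for n = 1, l is constant in t); u(s,n,c,0), undefined as written, is set to 1; the condition on s* is proved optimal for each u(·,n,c,p), with its own s for each p, since for r ≥ 2 a single s need not minimise the whole sum. *)

theory Defs
  imports "HOL-Probability.Probability"
begin

(* HOL's geometric_pmf counts failures and so lives on {0,1,...}; the summands here live on
   {1,2,...}, hence the Suc. *)
definition neg_bin :: "nat \<Rightarrow> real \<Rightarrow> nat pmf" where
  "neg_bin c q =
     map_pmf (\<lambda>x. \<Sum>i<c. x i) (Pi_pmf {..<c} 0 (\<lambda>_. map_pmf Suc (geometric_pmf q)))"

definition gamma_law :: "nat \<Rightarrow> real measure" where
  "gamma_law c =
     distr (\<Pi>\<^sub>M i\<in>{..<c}. density lborel (exponential_density 1)) borel (\<lambda>x. \<Sum>i<c. x i)"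

definition gamma_moment :: "nat \<Rightarrow> nat \<Rightarrow> real" where
  "gamma_moment c r = (\<integral>y. y ^ r \<partial>gamma_law c)"

definition upper_Gamma :: "real \<Rightarrow> real \<Rightarrow> real" where
  "upper_Gamma a x = (LBINT t:{x..}. t powr (a - 1) * exp (- t))"

definition Q :: "nat \<Rightarrow> real \<Rightarrow> real" where
  "Q c x = upper_Gamma (real c) x / Gamma (real c)"

(* Q c is a bijection from {0..} onto {0<..1}. *)
definition Q_inv :: "nat \<Rightarrow> real \<Rightarrow> real" where
  "Q_inv c = the_inv_into {0..} (Q c)"

definition \<phi> :: "real \<Rightarrow> real" where
  "\<phi> q = - ln (1 - q)"

definition sample_max :: "nat \<Rightarrow> (nat \<Rightarrow> 'a \<Rightarrow> nat) \<Rightarrow> 'a \<Rightarrow> nat" where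
  "sample_max n Y \<omega> = Max ((\<lambda>j. Y j \<omega>) ` {1..n})"

definition l :: "real \<Rightarrow> nat \<Rightarrow> nat \<Rightarrow> nat \<Rightarrow> real" where
  "l t n c r = t ^ r - (t ^ r - gamma_moment c r) * (1 - Q c t) ^ (n - 1)"

(* For r = 0 the exponents 1/r have no meaning. The term bounds a zeroth moment, so its value
   is set to 1.

   At s = 0 and r > 0, the product of s powr ((c + r - 1) / r) with the sum stands for the sum
   of the terms s powr ((c + r - 1 - m) / r) / Gamma (c + r - m) over m < r. Their exponents
   are positive, so they vanish at s = 0, and so does the product, despite 0 powr 0 = 0 and
   1 / 0 = 0 inside the sum. *)
definition u :: "real \<Rightarrow> nat \<Rightarrow> nat \<Rightarrow> nat \<Rightarrow> real" where
  "u s n c r =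
     (if r = 0 then 1
      else s + real n *
        ((Gamma (real (c + r)) / Gamma (real c) - s) * Q c (s powr (1 / real r))
         + Gamma (real (c + r)) / Gamma (real c)
           * s powr (real (c + r - 1) / real r) * exp (- (s powr (1 / real r)))
           * (\<Sum>m<r. 1 / (s powr (real m / real r) * Gamma (real (c + r - m))))))"

end

theory Submission
  imports Defs
begin

text \<open>If \<open>X\<close> is a unit exponential variable, then \<open>\<lceil>X / \<phi> q\<rceil>\<close> is geometric with success probability \<open>q\<close>.
  A negative binomial variable can therefore be realised as \<open>N = (\<Sum>i<c. \<lceil>X\<^sub>i / \<phi> q\<rceil>)\<close>, which lies between
  \<open>G / \<phi> q\<close> and \<open>G / \<phi> q + c\<close> for the Gamma variable \<open>G = (\<Sum>i<c. X\<^sub>i)\<close>. This reduces both bounds to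
  moments of the maximum of \<open>G\<^sub>1, \<dots>, G\<^sub>n\<close>. The lower bound conditions on whether one of \<open>G\<^sub>2, \<dots>, G\<^sub>n\<close>
  exceeds \<open>t\<close>. The upper bound expands \<open>(G / \<phi> q + c)\<^sup>r\<close> and uses
  \<open>max\<^sub>j G\<^sub>j\<^sup>p \<le> s + (\<Sum>j. max (G\<^sub>j\<^sup>p - s) 0)\<close>, where the right-hand side has expectation \<open>u s n c p\<close>.

  In the variable \<open>x = s powr (1 / p)\<close> the derivative of \<open>u\<close> is \<open>p x\<^sup>p\<^sup>-\<^sup>1 (1 - n Q c x)\<close>. Stationarity of \<open>l\<close> in \<open>t\<close>
  equates a strictly increasing function with the reciprocal hazard rate of the maximum of \<open>n - 1\<close>
  Gamma variables, which is nonincreasing, so there is exactly one stationary point.\<close>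

section \<open>The Gamma tail\<close>

text \<open>The probability of fewer than \<open>c\<close> points of a unit-rate Poisson process up
  to time \<open>x\<close>, hence the survival function of the Gamma law of shape
  \<open>c \<ge> 1\<close> on \<open>x \<ge> 0\<close>. This finite form is easy to differentiate,
  so the later analysis works with it and not with the integral in \<open>Q\<close>.\<close>

definition gamma_tail :: "nat \<Rightarrow> real \<Rightarrow> real" where
  "gamma_tail c x = (\<Sum>j<c. x ^ j / fact j) * exp (- x)"

text \<open>The derivative of the sum telescopes; only the top term survives, and it is minus the
  Gamma density.\<close>

lemma gamma_tail_deriv:
  "(gamma_tail (Suc k) has_real_derivative - (x ^ k / fact k * exp (- x))) (at x)"
proof (induction k)
  case 0
  show ?case by (auto simp: gamma_tail_def[abs_def] intro!: derivative_eq_intros)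
next
  case (Suc k)
  have eq: "gamma_tail (Suc (Suc k)) = (\<lambda>x. gamma_tail (Suc k) x + x ^ Suc k / fact (Suc k) * exp (- x))"
    by (simp add: gamma_tail_def fun_eq_iff algebra_simps)
  show ?case
    unfolding eq
  proof (rule DERIV_cong[OF DERIV_add[OF Suc.IH]])
    have "((\<lambda>x. x ^ Suc k / fact (Suc k)) has_real_derivative x ^ k / fact k) (at x)"
      using DERIV_cdivide[OF DERIV_pow[of "Suc k" x], of "fact (Suc k)"]
      by (simp del: of_nat_Suc power_Suc)
    from DERIV_mult[OF this DERIV_fun_exp[OF DERIV_minus[OF DERIV_ident]]]
    show "((\<lambda>x. x ^ Suc k / fact (Suc k) * exp (- x)) has_real_derivative
        (x ^ k / fact k * exp (- x) - x ^ Suc k / fact (Suc k) * exp (- x))) (at x)"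
      by (simp del: fact_Suc power_Suc add: mult.commute)
  qed simp
qed

lemma gamma_tail_0: "c \<ge> 1 \<Longrightarrow> gamma_tail c 0 = 1"
  by (cases c) (simp_all add: gamma_tail_def sum.lessThan_Suc_shift del: sum.lessThan_Suc)

lemma gamma_tail_pos: "c \<ge> 1 \<Longrightarrow> x \<ge> 0 \<Longrightarrow> gamma_tail c x > 0"
  unfolding gamma_tail_def
  by (intro mult_pos_pos) (auto intro!: sum_pos2[where i=0])

lemma gamma_tail_strict_antimono:
  assumes "c \<ge> 1" "0 \<le> x" "x < y"
  shows "gamma_tail c y < gamma_tail c x"
proof -
  obtain k where c: "c = Suc k" using assms(1) by (cases c) auto
  show ?thesis
    unfolding c
  proof (rule DERIV_neg_imp_decreasing_open[OF assms(3)])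
    fix z assume z: "x < z" "z < y"
    show "\<exists>d. (gamma_tail (Suc k) has_real_derivative d) (at z) \<and> d < 0"
      using z assms
      by (intro exI[of _ "- (z ^ k / fact k * exp (- z))"] conjI gamma_tail_deriv) auto
  next
    show "continuous_on {x..y} (gamma_tail (Suc k))"
      by (intro continuous_at_imp_continuous_on ballI DERIV_isCont[OF gamma_tail_deriv])
  qed
qed

lemma gamma_tail_less_1: "c \<ge> 1 \<Longrightarrow> x > 0 \<Longrightarrow> gamma_tail c x < 1"
  using gamma_tail_strict_antimono[of c 0 x] by (simp add: gamma_tail_0)

lemma continuous_on_gamma_tail: "continuous_on A (gamma_tail c)"
  unfolding gamma_tail_def by (intro continuous_intros) auto

lemma gamma_tail_tendsto_0: "(gamma_tail c \<longlongrightarrow> 0) at_top"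
proof -
  have "((\<lambda>x. \<Sum>j<c. (x ^ j / exp x) / fact j) \<longlongrightarrow> (\<Sum>j<c. 0 / fact j)) (at_top :: real filter)"
    by (intro tendsto_intros tendsto_power_div_exp_0) simp_all
  then show ?thesis
    by (simp add: gamma_tail_def[abs_def] sum_distrib_left exp_minus divide_inverse mult_ac)
qed

text \<open>Intermediate value theorem between the value \<open>1\<close> at \<open>0\<close> and
  the limit \<open>0\<close> at infinity.\<close>

lemma gamma_tail_attains:
  assumes "c \<ge> 1" "0 < a" "a \<le> 1"
  obtains x where "x \<ge> 0" "gamma_tail c x = a"
proof -
  have "eventually (\<lambda>x. gamma_tail c x < a \<and> x \<ge> 0) at_top"
    by (intro eventually_conj order_tendstoD(2)[OF gamma_tail_tendsto_0] eventually_ge_at_top assms)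
  then obtain b where "b \<ge> 0" "gamma_tail c b < a"
    by (auto simp: eventually_at_top_linorder)
  then have "\<exists>x\<ge>0. x \<le> b \<and> gamma_tail c x = a"
    by (intro IVT2' continuous_on_gamma_tail) (use assms in \<open>auto simp: gamma_tail_0\<close>)
  then show thesis using that by auto
qed

text \<open>The extra terms have indices from \<open>c\<close> to \<open>c + p - 1\<close>. They are
  listed in descending order because the sum in \<open>u\<close> runs that way.\<close>

lemma gamma_tail_add:
  "gamma_tail (c + p) x = gamma_tail c x + (\<Sum>m<p. x ^ (c + p - 1 - m) / fact (c + p - 1 - m)) * exp (- x)"
proof -
  have "(\<Sum>m<p. x ^ (c + p - 1 - m) / fact (c + p - 1 - m)) = (\<Sum>j\<in>{c..<c+p}. x ^ j / fact j)"
    by (rule sum.reindex_bij_witness[where i="\<lambda>j. c + p - 1 - j" and j="\<lambda>m. c + p - 1 - m"]) auto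
  moreover have "(\<Sum>j<c+p. x ^ j / fact j) = (\<Sum>j<c. x ^ j / fact j) + (\<Sum>j\<in>{c..<c+p}. x ^ j / fact j)"
    by (simp add: lessThan_atLeast0 sum.atLeastLessThan_concat)
  ultimately show ?thesis by (simp add: gamma_tail_def algebra_simps)
qed

section \<open>Agreement of the finite tail with the Erlang law and with \<open>Q\<close>\<close>

lemma gamma_tail_eq_erlang_CDF: "x \<ge> 0 \<Longrightarrow> gamma_tail (Suc k) x = 1 - erlang_CDF k 1 x"
  by (simp add: gamma_tail_def erlang_CDF_def sum_distrib_right lessThan_Suc_atMost)

text \<open>The index of \<open>erlang_density\<close> is one less than the shape, hence
  \<open>Suc k\<close> on the right.\<close>

lemma measure_erlang_greaterThan:
  assumes "x \<ge> 0"
  shows "measure (density lborel (erlang_density k 1)) {x<..} = gamma_tail (Suc k) x"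
proof -
  interpret prob_space "density lborel (erlang_density k 1)"
    by (rule prob_space_erlang_density) simp
  have "prob {..x} = erlang_CDF k 1 x"
    by (simp add: measure_def emeasure_erlang_density)
  moreover have "prob (space (density lborel (erlang_density k 1)) - {..x}) = 1 - prob {..x}"
    by (rule prob_compl) simp
  moreover have "UNIV - {..x} = {x<..}" by auto
  ultimately show ?thesis
    using assms by (simp add: gamma_tail_eq_erlang_CDF)
qed

lemma set_integral_erlang_greaterThan:
  assumes "x \<ge> 0"
  shows "(LBINT t:{x<..}. erlang_density k 1 t) = gamma_tail (Suc k) x"
    "set_integrable lborel {x<..} (erlang_density k 1)"
proof -
  have "measure (density lborel (erlang_density k 1)) {x<..}
      = (\<integral>t. indicator {x<..} t \<partial>density lborel (erlang_density k 1))"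
    by simp
  also have "\<dots> = (LBINT t:{x<..}. erlang_density k 1 t)"
    unfolding set_lebesgue_integral_def
    by (subst integral_real_density) (auto simp: mult.commute)
  finally show "(LBINT t:{x<..}. erlang_density k 1 t) = gamma_tail (Suc k) x"
    using measure_erlang_greaterThan[OF assms] by simp
  \<comment> \<open>A non-integrable function would have integral \<open>0\<close>, but the tail is
    positive.\<close>
  then show "set_integrable lborel {x<..} (erlang_density k 1)"
    using gamma_tail_pos[of "Suc k" x] assms not_integrable_integral_eq
    unfolding set_integrable_def set_lebesgue_integral_def by fastforce
qed

lemma Q_eq_gamma_tail:
  assumes "c \<ge> 1" "x \<ge> 0"
  shows "Q c x = gamma_tail c x"
proof -
  obtain k where c: "c = Suc k" using assms(1) by (cases c) auto
  have "upper_Gamma (real c) x = (LBINT t. fact k * (indicator {x<..} t *\<^sub>R erlang_density k 1 t))"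
    unfolding upper_Gamma_def set_lebesgue_integral_def
  proof (rule integral_cong_AE)
    \<comment> \<open>Discarding the point \<open>x\<close> identifies the two half-lines and leaves
      only \<open>t > 0\<close> to compare, where \<open>powr\<close> agrees with the natural
      power.\<close>
    show "AE t in lborel. indicator {x..} t *\<^sub>R (t powr (real c - 1) * exp (- t))
        = fact k * (indicator {x<..} t *\<^sub>R erlang_density k 1 t)"
      using AE_lborel_singleton[of x]
      by eventually_elim
        (use assms in \<open>auto simp: c erlang_density_def powr_realpow split: split_indicator\<close>)
  qed auto
  also have "\<dots> = fact k * gamma_tail c x"
    using set_integral_erlang_greaterThan(1)[OF assms(2), of k]
    by (simp add: c set_lebesgue_integral_def)
  finally show ?thesis
    using Gamma_fact[of k, where ?'a = real] by (simp add: Q_def c add.commute)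
qed

section \<open>Minimising the upper bound\<close>

text \<open>In the variable \<open>x = s powr (1 / p)\<close> the fractional powers vanish, and by
  \<open>gamma_tail_add\<close> the sum in \<open>u\<close> merges with \<open>Q\<close> into one
  tail of shape \<open>c + p\<close>. The bracket becomes the mean excess of the \<open>p\<close>-th
  power of a Gamma variable over \<open>x ^ p\<close>.\<close>

lemma u_power:
  assumes "c \<ge> 1" "p \<ge> 1" "x \<ge> 0"
  shows "u (x ^ p) n c p = x ^ p + real n *
    (fact (c + p - 1) / fact (c - 1) * gamma_tail (c + p) x - x ^ p * gamma_tail c x)"
proof -
  have Gam: "Gamma (real m) = fact (m - 1)" if "m \<ge> 1" for m
    using Gamma_fact[of "m - 1", where ?'a = real] that by (simp add: of_nat_diff)
  have root: "(x ^ p) powr (1 / real p) = x"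
    using assms by (cases "x = 0") (simp_all add: powr_powr flip: powr_realpow)
  show ?thesis
  \<comment> \<open>At \<open>x = 0\<close> the factors \<open>1 / x ^ m\<close> cannot be
    cancelled, so both sides are evaluated directly.\<close>
  proof (cases "x = 0")
    case True
    then show ?thesis
      using assms by (simp add: u_def Q_eq_gamma_tail gamma_tail_0 Gam power_0_left del: of_nat_add)
  next
    case False
    then have x: "x > 0" using assms by simp
    have pw: "(x ^ p) powr (real m / real p) = x ^ m" for m
      using assms x by (simp add: powr_powr flip: powr_realpow)
    have "x ^ (c + p - 1) * (\<Sum>m<p. 1 / (x ^ m * Gamma (real (c + p - m))))
        = (\<Sum>m<p. x ^ (c + p - 1 - m) / fact (c + p - 1 - m))"
      unfolding sum_distrib_left
    proof (rule sum.cong[OF refl])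
      fix m assume "m \<in> {..<p}"
      then show "x ^ (c + p - 1) * (1 / (x ^ m * Gamma (real (c + p - m))))
          = x ^ (c + p - 1 - m) / fact (c + p - 1 - m)"
        using x by (subst Gam) (simp_all add: power_diff diff_right_commute)
    qed
    then have "gamma_tail (c + p) x = gamma_tail c x
        + x ^ (c + p - 1) * (\<Sum>m<p. 1 / (x ^ m * Gamma (real (c + p - m)))) * exp (- x)"
      by (simp add: gamma_tail_add)
    moreover have "(x ^ p) powr ((real (c + p) - 1) / real p) = x ^ (c + p - 1)"
      using pw[of "c + p - 1"] assms by (simp add: of_nat_diff del: of_nat_add)
    ultimately show ?thesis
      using assms
      by (simp add: u_def root pw Q_eq_gamma_tail Gam[of c] Gam[of "c + p"] algebra_simps
          del: of_nat_add)
  qed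
qed

text \<open>The two density terms cancel: the density of shape \<open>c + p\<close>, times the
  quotient of factorials, is \<open>x ^ p\<close> times the density of shape
  \<open>c\<close>.\<close>

lemma u_power_deriv:
  assumes "c \<ge> 1" "p \<ge> 1"
  shows "((\<lambda>x. x ^ p + real n *
      (fact (c + p - 1) / fact (c - 1) * gamma_tail (c + p) x - x ^ p * gamma_tail c x))
    has_real_derivative real p * x ^ (p - 1) * (1 - real n * gamma_tail c x)) (at x)"
proof -
  obtain k where c: "c = Suc k" using assms by (cases c) auto
  have 1: "(gamma_tail (c + p) has_real_derivative - (x ^ (k + p) / fact (k + p) * exp (- x))) (at x)"
    using gamma_tail_deriv[of "k + p"] by (simp add: c)
  have 2: "(gamma_tail c has_real_derivative - (x ^ k / fact k * exp (- x))) (at x)"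
    using gamma_tail_deriv[of k] by (simp add: c)
  show ?thesis
    by (rule derivative_eq_intros 1 2 refl)+ (simp add: c power_add algebra_simps)
qed

text \<open>Since the tail strictly decreases, the factor \<open>1 - n * gamma_tail c y\<close> is
  negative before \<open>a\<close> and positive after it.\<close>

lemma u_power_strict_min:
  assumes "c \<ge> 1" "p \<ge> 1" "a \<ge> 0" "real n * gamma_tail c a = 1" "x \<ge> 0" "x \<noteq> a"
  shows "u (a ^ p) n c p < u (x ^ p) n c p"
proof -
  define V where "V = (\<lambda>x. x ^ p + real n *
      (fact (c + p - 1) / fact (c - 1) * gamma_tail (c + p) x - x ^ p * gamma_tail c x))"
  have V: "(V has_real_derivative real p * y ^ (p - 1) * (1 - real n * gamma_tail c y)) (at y)" for y
    unfolding V_def by (rule u_power_deriv) fact+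
  have cont: "continuous_on A V" for A
    by (intro continuous_at_imp_continuous_on ballI DERIV_isCont[OF V])
  have n: "n > 0" using assms(4) by (cases n) auto
  have "V a < V x"
  proof (cases "x < a")
    case True
    show ?thesis
    proof (rule DERIV_neg_imp_decreasing_open[OF True _ cont])
      fix y assume y: "x < y" "y < a"
      have "real n * gamma_tail c a < real n * gamma_tail c y"
        using y assms n by (intro mult_strict_left_mono gamma_tail_strict_antimono) auto
      then show "\<exists>d. (V has_real_derivative d) (at y) \<and> d < 0"
        using y assms by (intro exI[of _ "real p * y ^ (p - 1) * (1 - real n * gamma_tail c y)"] conjI V mult_pos_neg) auto
    qed
  next
    case False
    then have "a < x" using assms by simp
    then show ?thesis
    proof (rule DERIV_pos_imp_increasing_open[OF _ _ cont])
      fix y assume y: "a < y" "y < x"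
      have "real n * gamma_tail c y < real n * gamma_tail c a"
        using y assms n by (intro mult_strict_left_mono gamma_tail_strict_antimono) auto
      then show "\<exists>d. (V has_real_derivative d) (at y) \<and> d > 0"
        using y assms by (intro exI[of _ "real p * y ^ (p - 1) * (1 - real n * gamma_tail c y)"] conjI V mult_pos_pos) auto
    qed
  qed
  then show ?thesis using assms by (simp add: u_power V_def)
qed

lemma ex_n_gamma_tail_eq_1:
  assumes "n \<ge> 1" "c \<ge> 1"
  obtains a where "a \<ge> 0" "real n * gamma_tail c a = 1"
  using gamma_tail_attains[of c "1 / real n"] assms by (auto simp: field_simps)

text \<open>Any root of the optimality equation is a strict minimiser, and a root \<open>a\<close>
  exists. A minimiser other than \<open>a ^ p\<close> would therefore be beaten by it.\<close>

lemma u_minimal_iff: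
  assumes "n \<ge> 1" "c \<ge> 1" "p \<ge> 1" "s \<ge> 0"
  shows "real n * Q c (s powr (1 / real p)) = 1 \<longleftrightarrow> (\<forall>s'\<ge>0. u s n c p \<le> u s' n c p)"
proof -
  have root: "s = (s powr (1 / real p)) ^ p" if "s \<ge> 0" for s :: real
    using assms that by (cases "s = 0") (simp_all add: powr_powr powr_realpow[symmetric] zero_power)
  define x where "x = s powr (1 / real p)"
  have x: "x \<ge> 0" "s = x ^ p" using root[OF assms(4)] by (auto simp: x_def)
  obtain a where a: "a \<ge> 0" "real n * gamma_tail c a = 1"
    using ex_n_gamma_tail_eq_1 assms by metis
  have "real n * gamma_tail c x = 1 \<longleftrightarrow> (\<forall>s'\<ge>0. u s n c p \<le> u s' n c p)"
  proof
    assume *: "real n * gamma_tail c x = 1"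
    show "\<forall>s'\<ge>0. u s n c p \<le> u s' n c p"
    proof (intro allI impI)
      fix s' :: real assume "s' \<ge> 0"
      then show "u s n c p \<le> u s' n c p"
        using u_power_strict_min[OF assms(2,3) x(1) *, of "s' powr (1 / real p)"] root[of s'] x(2)
        by (cases "s' powr (1 / real p) = x") auto
    qed
  next
    assume *: "\<forall>s'\<ge>0. u s n c p \<le> u s' n c p"
    have "x = a"
    proof (rule ccontr)
      assume "x \<noteq> a"
      then have "u (a ^ p) n c p < u s n c p"
        unfolding x(2) using assms x a by (intro u_power_strict_min) auto
      with * a show False by (simp add: not_less[symmetric])
    qed
    then show "real n * gamma_tail c x = 1" using a by simp
  qed
  moreover have "Q c (s powr (1 / real p)) = gamma_tail c x"
    using assms(2) by (simp add: Q_eq_gamma_tail x_def)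
  ultimately show ?thesis by simp
qed

lemma Q_Q_inv:
  assumes "n \<ge> 1" "c \<ge> 1"
  shows "Q_inv c (1 / real n) \<ge> 0" "real n * Q c (Q_inv c (1 / real n)) = 1"
proof -
  obtain a where a: "a \<ge> 0" "real n * gamma_tail c a = 1"
    using ex_n_gamma_tail_eq_1 assms by metis
  \<comment> \<open>Injectivity makes \<open>the_inv_into\<close> return the root \<open>a\<close>
    itself.\<close>
  have inj: "inj_on (Q c) {0..}"
  proof (rule inj_onI)
    fix x y assume "x \<in> {0..}" "y \<in> {0..}" "Q c x = Q c y"
    then show "x = y"
      using gamma_tail_strict_antimono[of c x y] gamma_tail_strict_antimono[of c y x] assms
      by (cases x y rule: linorder_cases) (auto simp: Q_eq_gamma_tail)
  qed
  have "Q c a = 1 / real n"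
    using a assms by (simp add: Q_eq_gamma_tail field_simps)
  then have "Q_inv c (1 / real n) = a"
    unfolding Q_inv_def using inj a by (intro the_inv_into_f_eq) auto
  then show "Q_inv c (1 / real n) \<ge> 0" "real n * Q c (Q_inv c (1 / real n)) = 1"
    using a assms by (simp_all add: Q_eq_gamma_tail)
qed

text \<open>For \<open>p = 1\<close> the terms \<open>x\<close> and \<open>n * x * Q c x\<close>
  cancel at the optimum; the factor \<open>c\<close> is
  \<open>fact c / fact (c - 1)\<close>.\<close>

lemma u_1_optimal:
  assumes "c \<ge> 1" "x \<ge> 0" "real n * Q c x = 1"
  shows "u x n c 1 = real c * real n * Q (c + 1) x"
proof -
  have "fact c / fact (c - 1) = real c"
    using assms(1) by (cases c) auto
  moreover have "x * (real n * gamma_tail c x) = x"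
    using assms by (simp add: Q_eq_gamma_tail)
  ultimately show ?thesis
    using assms u_power[of c 1 x n] by (simp add: Q_eq_gamma_tail algebra_simps)
qed

section \<open>The stationary point of the lower bound\<close>

text \<open>Here \<open>G\<close> and \<open>g\<close> are the Gamma distribution function and density, and \<open>R\<close> is the reciprocal hazard
  rate \<open>(1 - G\<^sup>k) / (k G\<^sup>k\<^sup>-\<^sup>1 g)\<close> of the maximum of \<open>k\<close> Gamma variables. It is written as a product of the
  reciprocal hazard rate \<open>H\<close> of one variable and the mean of the powers \<open>(1 / G)\<^sup>i\<close>, \<open>i < k\<close>, so that
  monotonicity is visible in each factor.\<close>

lemma lower_bound_stationary:
  assumes "c \<ge> 1" "r \<ge> 1" "k \<ge> 1" "b > 0"
    and f_def: "f = (\<lambda>t. t ^ r - (t ^ r - b ^ r) * (1 - gamma_tail c t) ^ k)"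
  obtains t0 where "t0 \<ge> b" "(f has_real_derivative 0) (at t0)" "\<And>t. t \<ge> b \<Longrightarrow> f t \<le> f t0"
    "\<And>t. t \<ge> b \<Longrightarrow> (f has_real_derivative 0) (at t) \<Longrightarrow> t = t0"
proof -
  define G where "G = (\<lambda>t. 1 - gamma_tail c t)"
  define g where "g = (\<lambda>t::real. t ^ (c - 1) / fact (c - 1) * exp (- t))"
  define H where "H = (\<lambda>t::real. \<Sum>j<c. fact (c - 1) / fact j * (1 / t) ^ (c - 1 - j))"
  define E where "E = (\<lambda>t. \<Sum>j<k. (1 / G t) ^ (k - 1 - j))"
  define R where "R = (\<lambda>t. H t * E t / real k)"
  \<comment> \<open>For \<open>t > 0\<close>, \<open>L t\<close> equals
    \<open>(t ^ r - b ^ r) / (r * t ^ (r - 1))\<close>. With the positive factor \<open>D\<close>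
    taken out, the derivative of \<open>f\<close> is \<open>D t * (R t - L t)\<close>.\<close>
  define L where "L = (\<lambda>t. (t - b ^ r / t ^ (r - 1)) / real r)"
  define D where "D = (\<lambda>t. real r * t ^ (r - 1) * (real k * G t ^ (k - 1) * g t))"
  obtain r' where r': "r = Suc r'" using assms(2) by (cases r) auto
  obtain c' where c': "c = Suc c'" using assms(1) by (cases c) auto
  have G_pos: "G t > 0" if "t > 0" for t
    using gamma_tail_less_1 that assms by (simp add: G_def)
  have g_pos: "g t > 0" if "t > 0" for t
    using that by (simp add: g_def)
  have G_mono: "G s \<le> G t" if "0 < s" "s \<le> t" for s t
    using gamma_tail_strict_antimono[of c s t] that assms by (cases "s = t") (auto simp: G_def)
  have tail_H: "gamma_tail c t = H t * g t" if "t > 0" for t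
  proof -
    have "t ^ j / fact j = fact (c - 1) / fact j * (1 / t) ^ (c - 1 - j) * (t ^ (c - 1) / fact (c - 1))"
      if "j < c" for j
    proof -
      have "t ^ (c - 1) = t ^ j * t ^ (c - 1 - j)"
        using that by (simp flip: power_add)
      then show ?thesis using \<open>t > 0\<close> by (simp add: field_simps)
    qed
    then have "(\<Sum>j<c. t ^ j / fact j) = H t * (t ^ (c - 1) / fact (c - 1))"
      unfolding H_def sum_distrib_right by (intro sum.cong refl) (meson lessThan_iff)
    then show ?thesis
      unfolding gamma_tail_def g_def by (simp add: mult_ac)
  qed
  \<comment> \<open>Taking the top power out of the geometric sum of \<open>G t ^ j\<close> leaves
    powers of \<open>1 / G t\<close>, which are nonincreasing in \<open>t\<close>.\<close>
  have geom: "1 - G t ^ k = (1 - G t) * (E t * G t ^ (k - 1))" if "t > 0" for t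
  proof -
    have "G t ^ j = (1 / G t) ^ (k - 1 - j) * G t ^ (k - 1)" if "j < k" for j
    proof -
      have "G t ^ (k - 1) = G t ^ j * G t ^ (k - 1 - j)"
        using that by (simp flip: power_add)
      then show ?thesis using G_pos[OF \<open>t > 0\<close>] by (simp add: field_simps)
    qed
    then have "(\<Sum>j<k. G t ^ j) = E t * G t ^ (k - 1)"
      unfolding E_def sum_distrib_right by (intro sum.cong refl) (meson lessThan_iff)
    then show ?thesis
      unfolding one_diff_power_eq by simp
  qed
  have G_deriv: "(G has_real_derivative g t) (at t)" for t
    unfolding G_def g_def c' by (rule derivative_eq_intros gamma_tail_deriv refl)+ simp
  have f_eq: "f = (\<lambda>t. t ^ r - (t ^ r - b ^ r) * G t ^ k)"
    by (simp add: f_def G_def)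
  have f_deriv: "(f has_real_derivative D t * (R t - L t)) (at t)" if "t > 0" for t
  proof -
    have "(f has_real_derivative real r * t ^ (r - 1) * (1 - G t ^ k)
        - (t ^ r - b ^ r) * (real k * G t ^ (k - 1) * g t)) (at t)"
      unfolding f_eq
      by (rule derivative_eq_intros G_deriv refl)+ (simp add: algebra_simps)
    moreover have "real r * t ^ (r - 1) * (1 - G t ^ k) = D t * R t"
      using assms unfolding geom[OF that] D_def R_def
      by (simp add: G_def tail_H[OF that])
    moreover have "(t ^ r - b ^ r) * (real k * G t ^ (k - 1) * g t) = D t * L t"
    proof -
      have rL: "real r * L t = t - b ^ r / t ^ (r - 1)"
        using assms(2) by (simp add: L_def)
      have "t ^ r - b ^ r = t ^ (r - 1) * (real r * L t)"
        unfolding rL using that by (simp add: r' right_diff_distrib)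
      then show ?thesis by (simp add: D_def)
    qed
    ultimately show ?thesis by (simp add: algebra_simps)
  qed
  have D_pos: "D t > 0" if "t > 0" for t
    using that assms G_pos[OF that] g_pos[OF that] by (simp add: D_def)
  have H_anti: "H t \<le> H s" and H_pos: "H s > 0" if "0 < s" "s \<le> t" for s t
    unfolding H_def using that assms
    by (auto intro!: sum_mono mult_left_mono divide_right_mono power_mono divide_left_mono sum_pos
        simp: lessThan_empty_iff)
  have E_anti: "E t \<le> E s" and E_pos: "E s > 0" if "0 < s" "s \<le> t" for s t
    unfolding E_def using that assms G_mono[OF that] G_pos[of s] G_pos[of t]
    by (auto intro!: sum_mono power_mono divide_left_mono sum_pos simp: lessThan_empty_iff)
  have R_anti: "R t \<le> R s" if "0 < s" "s \<le> t" for s t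
    unfolding R_def using H_anti[OF that] E_anti[OF that] H_pos[of s s] E_pos[of t t] that
    by (intro divide_right_mono mult_mono) auto
  have R_pos: "R s > 0" if "0 < s" for s
    using H_pos[of s s] E_pos[of s s] that assms by (simp add: R_def)
  have L_mono: "L s < L t" if "0 < s" "s < t" for s t
  proof -
    have "b ^ r / t ^ (r - 1) \<le> b ^ r / s ^ (r - 1)"
      using that assms by (intro divide_left_mono power_mono) auto
    then show ?thesis using that assms by (simp add: L_def divide_strict_right_mono)
  qed
  \<comment> \<open>\<open>W\<close> has the sign of the derivative of \<open>f\<close> and strictly
    decreases, so its zero is the only stationary point and a maximum.\<close>
  define W where "W = (\<lambda>t. R t - L t)"
  have W_anti: "W t < W s" if "0 < s" "s < t" for s t
    using R_anti[of s t] L_mono[of s t] that by (simp add: W_def)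
  have L_b: "L b = 0" using assms(4) by (simp add: L_def r')
  \<comment> \<open>The right end of a bracket for the zero of \<open>W\<close>: as
    \<open>b ^ r / d ^ (r - 1) \<le> b\<close>, it follows that
    \<open>L d \<ge> (d - b) / r = R b \<ge> R d\<close>.\<close>
  define d where "d = b + real r * R b"
  have d: "d \<ge> b" "d > 0" using R_pos[of b] assms(4) by (auto simp: d_def add_pos_nonneg)
  have "R b \<le> L d"
  proof -
    have "b ^ r / d ^ (r - 1) \<le> b ^ r / b ^ (r - 1)"
      using d assms by (intro divide_left_mono power_mono) auto
    also have "\<dots> = b" using assms(4) by (simp add: r')
    finally have "(d - b) / real r \<le> L d"
      unfolding L_def by (intro divide_right_mono) auto
    then show ?thesis using assms by (simp add: d_def)
  qed
  then have "W d \<le> 0" using R_anti[of b d] d assms(4) by (simp add: W_def)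
  moreover have "W b \<ge> 0" using R_pos[of b] assms(4) by (simp add: W_def L_b)
  moreover have "continuous_on {b..d} W"
  proof -
    have "continuous_on {b..d} G"
      unfolding G_def by (intro continuous_intros continuous_on_gamma_tail)
    moreover have "G t \<noteq> 0" if "t \<ge> b" for t
      using G_pos[of t] that assms(4) by auto
    ultimately show ?thesis
      unfolding W_def R_def L_def H_def E_def using assms(2-4)
      by (intro continuous_intros) auto
  qed
  ultimately obtain t0 where t0: "t0 \<ge> b" "W t0 = 0"
    using IVT2'[of W d 0 b] d by auto
  have t0_pos: "t0 > 0" using t0 assms(4) by simp
  show thesis
  proof (rule that[OF t0(1)])
    show "(f has_real_derivative 0) (at t0)"
      using f_deriv[OF t0_pos] t0(2) by (simp add: W_def)
  next
    fix t assume t: "t \<ge> b"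
    show "f t \<le> f t0"
    proof (cases "t \<le> t0")
      case True
      then show ?thesis
      proof (rule DERIV_nonneg_imp_nondecreasing)
        fix x assume x: "t \<le> x" "x \<le> t0"
        have "W x \<ge> 0" using W_anti[of x t0] x t t0 assms(4) by (cases "x = t0") auto
        then show "\<exists>y. (f has_real_derivative y) (at x) \<and> 0 \<le> y"
          using f_deriv[of x] D_pos[of x] x t assms(4)
          by (intro exI[of _ "D x * W x"]) (auto simp: W_def)
      qed
    next
      case False
      then have "t0 \<le> t" by simp
      then show ?thesis
      proof (rule DERIV_nonpos_imp_nonincreasing)
        fix x assume x: "t0 \<le> x" "x \<le> t"
        have "W x \<le> 0" using W_anti[of t0 x] x t0 assms(4) by (cases "x = t0") auto
        then show "\<exists>y. (f has_real_derivative y) (at x) \<and> y \<le> 0"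
          using f_deriv[of x] D_pos[of x] x t0_pos
          by (intro exI[of _ "D x * W x"]) (auto simp: W_def mult_nonneg_nonpos)
      qed
    qed
  next
    fix t assume t: "t \<ge> b" "(f has_real_derivative 0) (at t)"
    then have "t > 0" using assms(4) by simp
    then have "W t = 0"
      using DERIV_unique[OF f_deriv t(2)] D_pos[of t] by (auto simp: W_def)
    then show "t = t0"
      using W_anti[of t t0] W_anti[of t0 t] \<open>t > 0\<close> t0_pos t0(2)
      by (cases t t0 rule: linorder_cases) auto
  qed
qed

lemma l_stationary:
  assumes "n \<ge> 1" "c \<ge> 1" "r \<ge> 1" "gamma_moment c r > 0"
  shows "\<exists>t\<^sub>0. t\<^sub>0 \<ge> gamma_moment c r powr (1 / real r)
        \<and> ((\<lambda>t. l t n c r) has_real_derivative 0) (at t\<^sub>0)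
        \<and> (\<forall>t. t \<ge> gamma_moment c r powr (1 / real r) \<longrightarrow> l t n c r \<le> l t\<^sub>0 n c r)
        \<and> (n \<ge> 2 \<longrightarrow>
             (\<forall>t. t \<ge> gamma_moment c r powr (1 / real r)
                  \<and> ((\<lambda>t. l t n c r) has_real_derivative 0) (at t) \<longrightarrow> t = t\<^sub>0))"
proof (cases "n \<ge> 2")
  case False
  \<comment> \<open>Here the exponent \<open>n - 1\<close> is \<open>0\<close>, so \<open>l\<close>
    is constant in \<open>t\<close> and every point is stationary.\<close>
  then have "n = 1" using assms by simp
  then show ?thesis by (auto simp: l_def)
next
  case True
  define b where "b = gamma_moment c r powr (1 / real r)"
  define f where "f = (\<lambda>t. t ^ r - (t ^ r - b ^ r) * (1 - gamma_tail c t) ^ (n - 1))"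
  have b: "b > 0" "b ^ r = gamma_moment c r"
    using assms by (auto simp: b_def powr_powr simp flip: powr_realpow)
  have l_eq: "l t n c r = f t" if "t > 0" for t
    using that assms by (simp add: l_def f_def b(2) Q_eq_gamma_tail)
  have deriv: "((\<lambda>t. l t n c r) has_real_derivative d) (at t) \<longleftrightarrow> (f has_real_derivative d) (at t)"
    if "t \<ge> b" for t d
  proof -
    \<comment> \<open>The two functions are identified on the positive reals only; this is an open
      set containing \<open>t\<close>, which suffices for derivatives.\<close>
    have "eventually (\<lambda>t. l t n c r = f t) (nhds t)"
      using eventually_nhds_in_open[of "{0<..}" t] that b(1)
      by (auto elim!: eventually_mono simp: l_eq)
    then show ?thesis by (intro DERIV_cong_ev) auto
  qed
  have k: "n - 1 \<ge> 1" using True by simp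
  obtain t0 where t0: "t0 \<ge> b" "(f has_real_derivative 0) (at t0)"
    "\<And>t. t \<ge> b \<Longrightarrow> f t \<le> f t0"
    "\<And>t. t \<ge> b \<Longrightarrow> (f has_real_derivative 0) (at t) \<Longrightarrow> t = t0"
    by (rule lower_bound_stationary[OF assms(2,3) k b(1) f_def]) (rule that; blast)
  have "l t n c r \<le> l t0 n c r" if "t \<ge> b" for t
    using t0(1,3) that b(1) by (simp add: l_eq)
  moreover have "t = t0" if "t \<ge> b" "((\<lambda>t. l t n c r) has_real_derivative 0) (at t)" for t
    using that(2) by (intro t0(4) that(1)) (simp add: deriv[OF that(1)])
  moreover have "((\<lambda>t. l t n c r) has_real_derivative 0) (at t0)"
    using t0(2) by (simp add: deriv[OF t0(1)])
  ultimately show ?thesis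
    unfolding b_def[symmetric] using t0(1) by blast
qed

section \<open>Ceilings of exponential variables\<close>

text \<open>Gives access to the Borel measurability rules for sums and maxima.\<close>

lemma measurable_count_space_nat:
  "measurable M (count_space (UNIV :: nat set)) = borel_measurable M"
  by (rule measurable_cong_sets) (simp_all add: sets_borel_eq_count_space)

abbreviation "unit_exp \<equiv> density lborel (exponential_density 1)"

abbreviation "exp_prod c \<equiv> PiM {..<c::nat} (\<lambda>_. unit_exp)"

lemma prob_space_unit_exp: "prob_space unit_exp"
  by (rule prob_space_exponential_density) simp

lemma prob_space_exp_prod: "prob_space (exp_prod c)"
  by (intro prob_space_PiM prob_space_unit_exp)

text \<open>Serves at both levels of the construction: for the \<open>c\<close> exponentials inside
  one variable, and for the \<open>n\<close> independent blocks of the coupling.\<close>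

lemma indep_vars_PiM_compose:
  assumes I: "finite I" "I \<noteq> {}" and M: "\<And>i. i \<in> I \<Longrightarrow> prob_space (M i)"
    and f: "\<And>i. i \<in> I \<Longrightarrow> f \<in> measurable (M i) (N i)"
  shows "prob_space.indep_vars (PiM I M) N (\<lambda>i \<omega>. f (\<omega> i)) I"
    and "\<And>i. i \<in> I \<Longrightarrow> distr (PiM I M) (N i) (\<lambda>\<omega>. f (\<omega> i)) = distr (M i) (N i) f"
    and "distr (PiM I M) (PiM I N) (\<lambda>\<omega>. \<lambda>i\<in>I. f (\<omega> i)) = PiM I (\<lambda>i. distr (M i) (N i) f)"
proof -
  interpret prob_space "PiM I M" by (intro prob_space_PiM M)
  show marg: "distr (PiM I M) (N i) (\<lambda>\<omega>. f (\<omega> i)) = distr (M i) (N i) f" if "i \<in> I" for i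
  proof -
    have "distr (PiM I M) (N i) (\<lambda>\<omega>. f (\<omega> i)) = distr (distr (PiM I M) (M i) (\<lambda>\<omega>. \<omega> i)) (N i) f"
      using that f by (subst distr_distr) (auto simp: comp_def)
    then show ?thesis using distr_PiM_component[of I M, OF M that] by simp
  qed
  have meas: "(\<lambda>\<omega>. f (\<omega> i)) \<in> measurable (PiM I M) (N i)" if "i \<in> I" for i
    by (rule measurable_compose[OF measurable_component_singleton[OF that, of M] f[OF that]])
  \<comment> \<open>The product rule is applied with probability measures as targets.
    \<open>N' i\<close> is one, and it has the same measurable sets as \<open>N i\<close>.\<close>
  define N' where "N' = (\<lambda>i. distr (M i) (N i) f)"
  have "prob_space (N' i)" if "i \<in> I" for i
    unfolding N'_def using that by (intro prob_space.prob_space_distr M f)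
  then have "distr (PiM I M) (PiM I N') (compose I f) = PiM I (\<lambda>i. distr (M i) (N' i) f)"
    using f by (intro distr_PiM_finite_prob_space' I M) (auto simp: N'_def)
  moreover have "distr (PiM I M) (PiM I N') (compose I f)
      = distr (PiM I M) (PiM I N) (\<lambda>\<omega>. \<lambda>i\<in>I. f (\<omega> i))"
    by (intro distr_cong refl sets_PiM_cong) (auto simp: N'_def compose_def)
  moreover have "distr (M i) (N' i) f = distr (M i) (N i) f" for i
    by (intro distr_cong) (auto simp: N'_def)
  ultimately show joint:
    "distr (PiM I M) (PiM I N) (\<lambda>\<omega>. \<lambda>i\<in>I. f (\<omega> i)) = PiM I (\<lambda>i. distr (M i) (N i) f)"
    by simp
  show "indep_vars N (\<lambda>i \<omega>. f (\<omega> i)) I"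
    using meas joint marg
    by (subst indep_vars_iff_distr_eq_PiM'[OF I(2)]) (auto cong: PiM_cong)
qed

lemma gamma_law_eq_erlang:
  assumes "c \<ge> 1"
  shows "gamma_law c = density lborel (erlang_density (c - 1) 1)"
proof -
  interpret prob_space "exp_prod c" by (rule prob_space_exp_prod)
  have I: "finite {..<c}" "{..<c} \<noteq> {}" using assms by (auto simp: lessThan_empty_iff)
  have "distributed (exp_prod c) lborel (\<lambda>x. \<Sum>i\<in>{..<c}. x i) (erlang_density (card {..<c} - 1) 1)"
  proof (rule exponential_distributed_sum[OF I])
    show "distributed (exp_prod c) lborel (\<lambda>x. x i) (exponential_density 1)" if "i \<in> {..<c}" for i
      using distr_PiM_component[of "{..<c}" "\<lambda>_. unit_exp" i] that prob_space_unit_exp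
        measurable_component_singleton[of i "{..<c}" "\<lambda>_. unit_exp"]
      by (auto simp: distributed_def cong: distr_cong)
    show "indep_vars (\<lambda>i. borel) (\<lambda>i x. x i) {..<c}"
      using indep_vars_PiM_compose(1)[OF I, of "\<lambda>_. unit_exp" "\<lambda>x. x" "\<lambda>_. borel"]
      by (simp add: prob_space_unit_exp)
  qed simp
  then show ?thesis
    unfolding gamma_law_def by (auto simp: distributed_def cong: distr_cong)
qed

text \<open>The ceiling is \<open>Suc m\<close> exactly between \<open>m * \<phi> q\<close> and
  \<open>Suc m * \<phi> q\<close>. As \<open>exp (- \<phi> q) = 1 - q\<close>, that interval has
  mass \<open>(1 - q) ^ m * q\<close>.\<close>

lemma distr_ceiling_exponential:
  assumes "0 < q" "q < 1"
  shows "distr unit_exp (count_space UNIV) (\<lambda>x. nat \<lceil>x / \<phi> q\<rceil>)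
    = measure_pmf (map_pmf Suc (geometric_pmf q))"
proof (rule measure_eqI_countable[where A=UNIV])
  fix k :: nat
  have \<phi>: "\<phi> q > 0" "exp (- \<phi> q) = 1 - q" using assms by (auto simp: \<phi>_def)
  interpret prob_space unit_exp by (rule prob_space_unit_exp)
  have le: "prob {..x} = 1 - exp (- x)" if "x \<ge> 0" for x
    using that by (simp add: measure_def emeasure_erlang_density erlang_CDF_0)
  have "emeasure (distr unit_exp (count_space UNIV) (\<lambda>x. nat \<lceil>x / \<phi> q\<rceil>)) {k}
      = prob ((\<lambda>x. nat \<lceil>x / \<phi> q\<rceil>) -` {k})"
    by (subst emeasure_distr) (auto simp: emeasure_eq_measure)
  also have "prob ((\<lambda>x. nat \<lceil>x / \<phi> q\<rceil>) -` {k}) = pmf (map_pmf Suc (geometric_pmf q)) k"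
  proof (cases k)
    case 0
    \<comment> \<open>\<open>nat\<close> sends all nonpositive ceilings to \<open>0\<close>, so this
      preimage is a half-line, which is a null set.\<close>
    have "(\<lambda>x. nat \<lceil>x / \<phi> q\<rceil>) -` {k} = {..0}"
      using \<phi> by (auto simp: 0 divide_le_0_iff)
    moreover have "pmf (map_pmf Suc (geometric_pmf q)) 0 = 0"
      by (simp add: pmf_eq_0_set_pmf)
    ultimately show ?thesis using le[of 0] by (simp add: 0)
  next
    case (Suc m)
    have "(\<lambda>x. nat \<lceil>x / \<phi> q\<rceil>) -` {k} = {..real (Suc m) * \<phi> q} - {..real m * \<phi> q}"
    proof -
      have ceil: "nat \<lceil>y\<rceil> = Suc m \<longleftrightarrow> real m < y \<and> y \<le> real (Suc m)" for y
        by linarith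
      have *: "nat \<lceil>x / \<phi> q\<rceil> = k \<longleftrightarrow> real m * \<phi> q < x \<and> x \<le> real (Suc m) * \<phi> q" for x
        unfolding Suc ceil using \<phi>(1) by (simp only: pos_less_divide_eq pos_divide_le_eq)
      show ?thesis
        unfolding set_eq_iff vimage_eq singleton_iff Diff_iff atMost_iff not_le * by blast
    qed
    then have "prob ((\<lambda>x. nat \<lceil>x / \<phi> q\<rceil>) -` {k})
        = prob {..real (Suc m) * \<phi> q} - prob {..real m * \<phi> q}"
      using \<phi> by (simp add: finite_measure_Diff)
    also have "\<dots> = exp (- (real m * \<phi> q)) - exp (- (real (Suc m) * \<phi> q))"
      using \<phi> by (simp add: le del: of_nat_Suc)
    also have "\<dots> = exp (- \<phi> q) ^ m - exp (- \<phi> q) ^ Suc m"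
      unfolding exp_of_nat_mult[symmetric] by simp
    also have "\<dots> = (1 - q) ^ m * q"
      by (simp add: \<phi> algebra_simps)
    also have "\<dots> = pmf (map_pmf Suc (geometric_pmf q)) k"
      using assms by (simp add: Suc pmf_map_inj')
    finally show ?thesis .
  qed
  finally show "emeasure (distr unit_exp (count_space UNIV) (\<lambda>x. nat \<lceil>x / \<phi> q\<rceil>)) {k}
      = emeasure (measure_pmf (map_pmf Suc (geometric_pmf q))) {k}"
    by (simp add: emeasure_pmf_single)
qed auto

lemma measurable_ceiling_sum [measurable]:
  "(\<lambda>x. \<Sum>i<c. nat \<lceil>x i / d\<rceil>) \<in> measurable (exp_prod c) (count_space UNIV)"
  unfolding measurable_count_space_nat
proof (rule borel_measurable_sum)
  fix i assume "i \<in> {..<c}"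
  then have [measurable]: "(\<lambda>x. x i) \<in> borel_measurable (exp_prod c)"
    using measurable_component_singleton[of i "{..<c}" "\<lambda>_. unit_exp"] by simp
  show "(\<lambda>x. nat \<lceil>x i / d\<rceil>) \<in> borel_measurable (exp_prod c)"
    unfolding measurable_count_space_nat[symmetric] by measurable
qed

lemma measurable_exp_sum [measurable]:
  "(\<lambda>x. \<Sum>i<c. x i) \<in> borel_measurable (exp_prod c)"
proof (rule borel_measurable_sum)
  fix i assume "i \<in> {..<c}"
  then show "(\<lambda>x. x i) \<in> borel_measurable (exp_prod c)"
    using measurable_component_singleton[of i "{..<c}" "\<lambda>_. unit_exp"] by simp
qed

text \<open>Both laws are images under the sum \<open>S\<close> of a joint law on \<open>c\<close>
  coordinates, so it suffices that these joint laws agree.\<close>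

lemma neg_bin_eq_distr:
  assumes "c \<ge> 1" "0 < q" "q < 1"
  shows "measure_pmf (neg_bin c q)
    = distr (exp_prod c) (count_space UNIV) (\<lambda>x. \<Sum>i<c. nat \<lceil>x i / \<phi> q\<rceil>)"
proof -
  let ?C = "count_space (UNIV :: nat set)"
  define p where "p = map_pmf Suc (geometric_pmf q)"
  define S where "S = (\<lambda>x :: nat \<Rightarrow> nat. \<Sum>i<c. x i)"
  define P where "P = Pi_pmf {..<c} 0 (\<lambda>_. p)"
  have I: "finite {..<c}" "{..<c} \<noteq> {}" using assms by (auto simp: lessThan_empty_iff)
  have "S \<in> borel_measurable (PiM {..<c} (\<lambda>_. ?C))"
    unfolding S_def
  proof (rule borel_measurable_sum)
    fix i assume "i \<in> {..<c}"
    then show "(\<lambda>x. x i) \<in> borel_measurable (PiM {..<c} (\<lambda>_. ?C))"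
      unfolding measurable_count_space_nat[symmetric] by (rule measurable_component_singleton)
  qed
  then have S: "S \<in> measurable (PiM {..<c} (\<lambda>_. ?C)) ?C"
    by (simp add: measurable_count_space_nat)
  \<comment> \<open>\<open>Pi_pmf\<close> puts the default \<open>0\<close> outside
    \<open>{..<c}\<close>, where points of \<open>PiM\<close> are \<open>undefined\<close>; the
    restriction reconciles the two.\<close>
  have "distr P (PiM {..<c} (\<lambda>_. ?C)) (\<lambda>f. \<lambda>i\<in>{..<c}. f i) = PiM {..<c} (\<lambda>i. distr P ?C (\<lambda>f. f i))"
    using prob_space.indep_vars_iff_distr_eq_PiM'[OF measure_pmf.prob_space_axioms[of P] I(2),
        of "\<lambda>i f. f i" "\<lambda>_. ?C"]
      indep_vars_Pi_pmf[OF I(1), of 0 "\<lambda>_. p"]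
    by (simp add: P_def)
  also have "\<dots> = PiM {..<c} (\<lambda>i. measure_pmf p)"
    by (intro PiM_cong) (simp_all add: P_def Pi_pmf_component flip: map_pmf_rep_eq)
  also have "\<dots> = distr (exp_prod c) (PiM {..<c} (\<lambda>_. ?C)) (\<lambda>x. \<lambda>i\<in>{..<c}. nat \<lceil>x i / \<phi> q\<rceil>)"
    by (subst indep_vars_PiM_compose(3)[OF I prob_space_unit_exp])
      (simp_all add: distr_ceiling_exponential assms p_def)
  finally have *: "distr P (PiM {..<c} (\<lambda>_. ?C)) (\<lambda>f. \<lambda>i\<in>{..<c}. f i)
      = distr (exp_prod c) (PiM {..<c} (\<lambda>_. ?C)) (\<lambda>x. \<lambda>i\<in>{..<c}. nat \<lceil>x i / \<phi> q\<rceil>)" .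
  have "measure_pmf (neg_bin c q) = distr P ?C S"
    unfolding neg_bin_def map_pmf_rep_eq P_def S_def p_def by simp
  also have "\<dots> = distr (distr P (PiM {..<c} (\<lambda>_. ?C)) (\<lambda>f. \<lambda>i\<in>{..<c}. f i)) ?C S"
    by (subst distr_distr[OF S]) (auto simp: S_def space_PiM intro!: distr_cong)
  also have "\<dots> = distr (exp_prod c) ?C (\<lambda>x. \<Sum>i<c. nat \<lceil>x i / \<phi> q\<rceil>)"
    unfolding *
  proof (subst distr_distr[OF S])
    show "(\<lambda>x. \<lambda>i\<in>{..<c}. nat \<lceil>x i / \<phi> q\<rceil>) \<in> measurable (exp_prod c) (PiM {..<c} (\<lambda>_. ?C))"
    proof (rule measurable_restrict)
      fix i assume "i \<in> {..<c}"
      then have [measurable]: "(\<lambda>x. x i) \<in> borel_measurable (exp_prod c)"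
        using measurable_component_singleton[of i "{..<c}" "\<lambda>_. unit_exp"] by simp
      show "(\<lambda>x. nat \<lceil>x i / \<phi> q\<rceil>) \<in> measurable (exp_prod c) ?C" by measurable
    qed
  qed (auto simp: S_def intro!: distr_cong)
  finally show ?thesis .
qed

section \<open>Moments of the sample maximum\<close>

lemma sample_max_measurable:
  assumes "n \<ge> 1" "\<And>j. j \<in> {1..n} \<Longrightarrow> N j \<in> measurable M (count_space UNIV)"
  shows "sample_max n N \<in> measurable M (count_space UNIV)"
  using assms unfolding sample_max_def[abs_def] measurable_count_space_nat
  by (intro borel_measurable_Max) auto

lemma sample_max_attained:
  assumes "n \<ge> 1"
  obtains j where "j \<in> {1..n}" "sample_max n N \<omega> = N j \<omega>"
proof -
  have "Max ((\<lambda>j. N j \<omega>) ` {1..n}) \<in> (\<lambda>j. N j \<omega>) ` {1..n}"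
    using assms by (intro Max_in) auto
  then show thesis using that by (auto simp: sample_max_def)
qed

lemma sample_max_ge: "j \<in> {1..n} \<Longrightarrow> N j \<omega> \<le> sample_max n N \<omega>"
  unfolding sample_max_def by (intro Max_ge) auto

section \<open>Truncated and full moments of one Gamma variable\<close>

lemma erlang_density_times_power:
  "erlang_density k 1 y * y ^ p = fact (k + p) / fact k * erlang_density (k + p) 1 y"
  by (simp add: erlang_density_def power_add)

text \<open>Above \<open>x\<close>, the weight \<open>y ^ p\<close> raises the Erlang index by
  \<open>p\<close>, so both parts of the excess integrate to tails.\<close>

lemma (in prob_space) erlang_excess_moment:
  assumes X: "distributed M lborel X (erlang_density k 1)" and "x \<ge> 0"
  shows "expectation (\<lambda>\<omega>. max (X \<omega> ^ p - x ^ p) 0)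
    = fact (k + p) / fact k * gamma_tail (Suc (k + p)) x - x ^ p * gamma_tail (Suc k) x"
proof -
  have eq: "erlang_density k 1 y * max (y ^ p - x ^ p) 0
      = fact (k + p) / fact k * (indicator {x<..} y *\<^sub>R erlang_density (k + p) 1 y)
        - x ^ p * (indicator {x<..} y *\<^sub>R erlang_density k 1 y)" for y
  proof (cases "y > x")
    case True
    then have "x ^ p \<le> y ^ p" using assms by (intro power_mono) auto
    then show ?thesis
      using True erlang_density_times_power[of k y p] by (simp add: algebra_simps)
  next
    case False
    \<comment> \<open>For negative \<open>y\<close> an even power may exceed \<open>x ^ p\<close>,
      but there the density vanishes.\<close>
    then have "y < 0 \<or> y ^ p \<le> x ^ p" using power_mono[of y x p] by linarith
    then show ?thesis using False by (auto simp: erlang_density_def)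
  qed
  have "expectation (\<lambda>\<omega>. max (X \<omega> ^ p - x ^ p) 0)
      = (LBINT y. erlang_density k 1 y * max (y ^ p - x ^ p) 0)"
    by (rule distributed_integral[symmetric, OF X]) auto
  also have "\<dots> = fact (k + p) / fact k * gamma_tail (Suc (k + p)) x - x ^ p * gamma_tail (Suc k) x"
    using set_integral_erlang_greaterThan[OF assms(2), of k]
      set_integral_erlang_greaterThan[OF assms(2), of "k + p"]
    unfolding eq set_lebesgue_integral_def set_integrable_def
    by (subst Bochner_Integration.integral_diff) auto
  finally show ?thesis .
qed

text \<open>The moment is a quotient of factorials. Its positivity makes the left end
  \<open>b\<close> of the stationarity argument positive.\<close>

lemma gamma_moment_pos:
  assumes "c \<ge> 1"
  shows "gamma_moment c r > 0"
proof -
  interpret prob_space "density lborel (erlang_density (c - 1) 1)"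
    by (rule prob_space_erlang_density) simp
  have "distributed (density lborel (erlang_density (c - 1) 1)) lborel (\<lambda>x. x)
      (erlang_density (c - 1) 1)"
    by (auto simp: distributed_def distr_id2)
  from erlang_ith_moment[OF _ this, of r] show ?thesis
    unfolding gamma_moment_def gamma_law_eq_erlang[OF assms] by simp
qed

text \<open>Collects the facts about the coupling from which both bounds are derived, with
  \<open>d\<close> in the role of \<open>\<phi> q\<close>. The sandwich holds almost surely because
  exponential variables are nonnegative only almost surely.\<close>

locale gamma_sandwich = prob_space M for M :: "'a measure" +
  fixes n c :: nat and d :: real and N :: "nat \<Rightarrow> 'a \<Rightarrow> nat" and G :: "nat \<Rightarrow> 'a \<Rightarrow> real"
  assumes n: "n \<ge> 1" and c: "c \<ge> 1" and d: "d > 0"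
    and N [measurable]: "\<And>j. j \<in> {1..n} \<Longrightarrow> N j \<in> measurable M (count_space UNIV)"
    and indep: "indep_vars (\<lambda>_. borel) G {1..n}"
    and distr_G: "\<And>j. j \<in> {1..n} \<Longrightarrow> distr M borel (G j) = gamma_law c"
    and sandwich: "AE \<omega> in M. \<forall>j\<in>{1..n}. 0 \<le> G j \<omega> \<and> G j \<omega> / d \<le> real (N j \<omega>)
      \<and> real (N j \<omega>) \<le> G j \<omega> / d + real c"
begin

lemma G_measurable [measurable]: "j \<in> {1..n} \<Longrightarrow> G j \<in> borel_measurable M"
  using indep by (auto simp: indep_vars_def)

lemma sample_max_N_measurable [measurable]: "sample_max n N \<in> measurable M (count_space UNIV)"
  using n N by (rule sample_max_measurable)

lemma G_distributed: "j \<in> {1..n} \<Longrightarrow> distributed M lborel (G j) (erlang_density (c - 1) 1)"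
  using distr_G[of j] gamma_law_eq_erlang[OF c] by (auto simp: distributed_def cong: distr_cong)

lemma G_power_integrable: "j \<in> {1..n} \<Longrightarrow> integrable M (\<lambda>\<omega>. G j \<omega> ^ p)"
  using erlang_ith_moment_integrable[OF _ G_distributed] by simp

lemma G_excess_integrable: "j \<in> {1..n} \<Longrightarrow> integrable M (\<lambda>\<omega>. max (G j \<omega> ^ p - s) 0)"
  using G_power_integrable by (intro integrable_max Bochner_Integration.integrable_diff) auto

lemma G_moment:
  assumes "j \<in> {1..n}"
  shows "expectation (\<lambda>\<omega>. G j \<omega> ^ p) = gamma_moment c p"
  unfolding gamma_moment_def distr_G[OF assms, symmetric]
  using assms by (subst integral_distr) auto

text \<open>The maximum is one of the \<open>N j\<close>, so the sum of all the upper estimates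
  dominates it. Without integrability the expectation would default to \<open>0\<close> and could
  not be compared.\<close>

lemma sample_max_moment_integrable: "integrable M (\<lambda>\<omega>. real (sample_max n N \<omega>) ^ r)"
proof (rule Bochner_Integration.integrable_bound)
  show "integrable M (\<lambda>\<omega>. \<Sum>j\<in>{1..n}. (G j \<omega> / d + real c) ^ r)"
    unfolding binomial_ring power_divide
    by (intro Bochner_Integration.integrable_sum integrable_mult_right integrable_mult_left
        integrable_divide G_power_integrable)
  show "AE \<omega> in M. norm (real (sample_max n N \<omega>) ^ r)
      \<le> norm (\<Sum>j\<in>{1..n}. (G j \<omega> / d + real c) ^ r)"
    using sandwich
  proof eventually_elim
    fix \<omega> assume \<omega>: "\<forall>j\<in>{1..n}. 0 \<le> G j \<omega> \<and> G j \<omega> / d \<le> real (N j \<omega>)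
      \<and> real (N j \<omega>) \<le> G j \<omega> / d + real c"
    obtain j where j: "j \<in> {1..n}" "sample_max n N \<omega> = N j \<omega>"
      using sample_max_attained[OF n] .
    have "real (sample_max n N \<omega>) ^ r \<le> (G j \<omega> / d + real c) ^ r"
      using \<omega> j by (intro power_mono) auto
    also have "\<dots> \<le> (\<Sum>j\<in>{1..n}. (G j \<omega> / d + real c) ^ r)"
      using \<omega> d j(1) by (intro member_le_sum) auto
    finally show "norm (real (sample_max n N \<omega>) ^ r)
        \<le> norm (\<Sum>j\<in>{1..n}. (G j \<omega> / d + real c) ^ r)"
      by simp
  qed
qed measurable

text \<open>If some \<open>G j\<close> with \<open>j \<noteq> 1\<close> exceeds \<open>t\<close>, the scaled maximum is at least \<open>t\<close>; otherwise it is
  bounded below by \<open>G 1\<close>, which is independent of that event.\<close>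

lemma sample_max_moment_ge:
  assumes "t \<ge> 0"
  shows "expectation (\<lambda>\<omega>. real (sample_max n N \<omega>) ^ r) \<ge> 1 / d ^ r * l t n c r"
proof -
  \<comment> \<open>The product of the \<open>h j (G j \<omega>)\<close> is
    \<open>G 1 \<omega> ^ r - t ^ r\<close> when no later variable exceeds \<open>t\<close>, and
    \<open>0\<close> otherwise. By independence its mean factorises, and adding \<open>t ^ r\<close>
    gives \<open>l\<close>.\<close>
  define h where "h = (\<lambda>(j :: nat) y. if j = 1 then y ^ r - t ^ r else (indicator {..t} y :: real))"
  have h_meas [measurable]: "h j \<in> borel_measurable borel" for j
    unfolding h_def by measurable
  have h_int: "integrable M (\<lambda>\<omega>. h j (G j \<omega>))" if "j \<in> {1..n}" for j
  proof (cases "j = 1")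
    case True
    then show ?thesis using G_power_integrable[OF that] by (simp add: h_def)
  next
    case False
    show ?thesis
      by (rule integrable_const_bound[where B=1])
        (use that False in \<open>auto simp: h_def indicator_def\<close>)
  qed
  have h_indep: "indep_vars (\<lambda>_. borel) (\<lambda>j \<omega>. h j (G j \<omega>)) {1..n}"
    by (rule indep_vars_compose2[OF indep]) measurable
  have split: "{1..n} = insert 1 {2..n}" using n by auto
  have exp_h: "expectation (\<lambda>\<omega>. h j (G j \<omega>)) = 1 - Q c t" if "j \<in> {2..n}" for j
  proof -
    have j: "j \<in> {1..n}" using that by auto
    have "expectation (\<lambda>\<omega>. h j (G j \<omega>)) = expectation (indicator {\<omega> \<in> space M. G j \<omega> \<le> t})"
      using that by (intro Bochner_Integration.integral_cong) (auto simp: h_def indicator_def)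
    also have "\<dots> = erlang_CDF (c - 1) 1 t"
      using erlang_distributed_le[OF G_distributed[OF j] _ assms] j by simp
    finally show ?thesis
      using gamma_tail_eq_erlang_CDF[OF assms, of "c - 1"] c assms
      by (simp add: Q_eq_gamma_tail)
  qed
  have "expectation (\<lambda>\<omega>. \<Prod>j\<in>{1..n}. h j (G j \<omega>)) = (\<Prod>j\<in>{1..n}. expectation (\<lambda>\<omega>. h j (G j \<omega>)))"
    by (rule indep_vars_lebesgue_integral[OF _ h_indep h_int]) auto
  also have "\<dots> = (gamma_moment c r - t ^ r) * (1 - Q c t) ^ (n - 1)"
  proof -
    have "expectation (\<lambda>\<omega>. h 1 (G 1 \<omega>)) = gamma_moment c r - t ^ r"
      using n G_power_integrable[of 1 r] G_moment[of 1 r] by (simp add: h_def prob_space)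
    then show ?thesis using exp_h unfolding split by simp
  qed
  finally have prod: "expectation (\<lambda>\<omega>. \<Prod>j\<in>{1..n}. h j (G j \<omega>))
      = (gamma_moment c r - t ^ r) * (1 - Q c t) ^ (n - 1)" .
  have prod_int: "integrable M (\<lambda>\<omega>. \<Prod>j\<in>{1..n}. h j (G j \<omega>))"
    by (rule indep_vars_integrable[OF _ h_indep h_int]) auto
  have "l t n c r = expectation (\<lambda>\<omega>. t ^ r + (\<Prod>j\<in>{1..n}. h j (G j \<omega>)))"
    using prod prod_int by (simp add: l_def prob_space algebra_simps)
  also have "\<dots> \<le> expectation (\<lambda>\<omega>. d ^ r * real (sample_max n N \<omega>) ^ r)"
  proof (rule integral_mono_AE)
    show "AE \<omega> in M. t ^ r + (\<Prod>j\<in>{1..n}. h j (G j \<omega>)) \<le> d ^ r * real (sample_max n N \<omega>) ^ r"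
      using sandwich
    proof eventually_elim
      fix \<omega> assume \<omega>: "\<forall>j\<in>{1..n}. 0 \<le> G j \<omega> \<and> G j \<omega> / d \<le> real (N j \<omega>)
        \<and> real (N j \<omega>) \<le> G j \<omega> / d + real c"
      have le: "G j \<omega> \<le> d * real (sample_max n N \<omega>)" if "j \<in> {1..n}" for j
      proof -
        have "G j \<omega> \<le> d * real (N j \<omega>)" using \<omega> that d by (auto simp: field_simps)
        also have "\<dots> \<le> d * real (sample_max n N \<omega>)"
          using sample_max_ge[OF that] d by simp
        finally show ?thesis .
      qed
      show "t ^ r + (\<Prod>j\<in>{1..n}. h j (G j \<omega>)) \<le> d ^ r * real (sample_max n N \<omega>) ^ r"
      proof (cases "\<forall>j\<in>{2..n}. G j \<omega> \<le> t")
        case True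
        then have "(\<Prod>j\<in>{1..n}. h j (G j \<omega>)) = G 1 \<omega> ^ r - t ^ r"
          unfolding split by (simp add: h_def)
        moreover have "G 1 \<omega> ^ r \<le> (d * real (sample_max n N \<omega>)) ^ r"
          using le[of 1] \<omega> n by (intro power_mono) auto
        ultimately show ?thesis by (simp add: power_mult_distrib)
      next
        case False
        then obtain j where j: "j \<in> {2..n}" "G j \<omega> > t" by auto
        then have "(\<Prod>j\<in>{1..n}. h j (G j \<omega>)) = 0"
          by (intro prod_zero) (auto simp: h_def intro!: bexI[of _ j])
        moreover have "t ^ r \<le> (d * real (sample_max n N \<omega>)) ^ r"
          using le[of j] j assms by (intro power_mono) auto
        ultimately show ?thesis by (simp only: power_mult_distrib add_0_right)
      qed
    qed
  qed (use prod_int sample_max_moment_integrable[of r] in auto)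
  finally show ?thesis
    using d by (simp add: field_simps)
qed

text \<open>The \<open>n\<close> excesses have the same mean, and \<open>u_power\<close> displays
  \<open>u\<close> as \<open>s\<close> plus \<open>n\<close> times that mean.\<close>

lemma u_eq_expectation:
  assumes "p \<ge> 1" "s \<ge> 0"
  shows "u s n c p = expectation (\<lambda>\<omega>. s + (\<Sum>j\<in>{1..n}. max (G j \<omega> ^ p - s) 0))"
proof -
  define x where "x = s powr (1 / real p)"
  have x: "x \<ge> 0" "s = x ^ p"
    using assms by (cases "s = 0"; simp add: x_def powr_powr zero_power flip: powr_realpow)+
  have "expectation (\<lambda>\<omega>. s + (\<Sum>j\<in>{1..n}. max (G j \<omega> ^ p - s) 0))
      = s + (\<Sum>j\<in>{1..n}. expectation (\<lambda>\<omega>. max (G j \<omega> ^ p - s) 0))"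
    using G_excess_integrable
    by (subst Bochner_Integration.integral_add) (auto simp: prob_space)
  also have "\<dots> = s + (\<Sum>j\<in>{1..n}. fact (c + p - 1) / fact (c - 1) * gamma_tail (c + p) x
      - x ^ p * gamma_tail c x)"
    using erlang_excess_moment[OF G_distributed x(1)] c by (simp add: x(2))
  also have "\<dots> = u s n c p"
    using c assms x by (simp add: u_power)
  finally show ?thesis by simp
qed

text \<open>Each power in the binomial expansion of \<open>(G / d + c) ^ r\<close> gets its own
  majorant, so the level \<open>s p\<close> may vary with \<open>p\<close>.\<close>

lemma sample_max_moment_le:
  assumes "\<And>p. s p \<ge> 0"
  shows "expectation (\<lambda>\<omega>. real (sample_max n N \<omega>) ^ r)
    \<le> (\<Sum>p=0..r. real (r choose p) * (1 / d ^ p) * u (s p) n c p * real c ^ (r - p))"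
proof -
  \<comment> \<open>The value \<open>1\<close> at \<open>p = 0\<close> matches the convention in
    \<open>u\<close>.\<close>
  define B where "B = (\<lambda>p \<omega>. if p = 0 then 1 else s p + (\<Sum>j\<in>{1..n}. max (G j \<omega> ^ p - s p) 0))"
  have B_int: "integrable M (B p)" for p
  proof (cases "p = 0")
    case False
    have "integrable M (\<lambda>\<omega>. s p + (\<Sum>j\<in>{1..n}. max (G j \<omega> ^ p - s p) 0))"
      by (intro Bochner_Integration.integrable_add Bochner_Integration.integrable_sum
          G_excess_integrable integrable_const)
    then show ?thesis using False by (simp add: B_def)
  qed (simp add: B_def)
  have B_exp: "expectation (B p) = u (s p) n c p" for p
    using assms u_eq_expectation[of p "s p"] by (cases "p = 0") (auto simp: B_def u_def prob_space)
  have "expectation (\<lambda>\<omega>. real (sample_max n N \<omega>) ^ r)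
    \<le> expectation (\<lambda>\<omega>. \<Sum>p=0..r. real (r choose p) * (1 / d ^ p) * B p \<omega> * real c ^ (r - p))"
  proof (rule integral_mono_AE)
    show "AE \<omega> in M. real (sample_max n N \<omega>) ^ r
        \<le> (\<Sum>p=0..r. real (r choose p) * (1 / d ^ p) * B p \<omega> * real c ^ (r - p))"
      using sandwich
    proof eventually_elim
      fix \<omega> assume \<omega>: "\<forall>j\<in>{1..n}. 0 \<le> G j \<omega> \<and> G j \<omega> / d \<le> real (N j \<omega>)
        \<and> real (N j \<omega>) \<le> G j \<omega> / d + real c"
      obtain j where j: "j \<in> {1..n}" "sample_max n N \<omega> = N j \<omega>"
        using sample_max_attained[OF n] .
      have le_B: "G j \<omega> ^ p \<le> B p \<omega>" for p
      proof (cases "p = 0")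
        case False
        have "max (G j \<omega> ^ p - s p) 0 \<le> (\<Sum>j\<in>{1..n}. max (G j \<omega> ^ p - s p) 0)"
          using j(1) by (intro member_le_sum) auto
        then show ?thesis using False by (simp add: B_def)
      qed (simp add: B_def)
      have "real (sample_max n N \<omega>) ^ r \<le> (G j \<omega> / d + real c) ^ r"
        using \<omega> j by (intro power_mono) auto
      also have "\<dots> = (\<Sum>p=0..r. real (r choose p) * (1 / d ^ p) * G j \<omega> ^ p * real c ^ (r - p))"
        unfolding binomial_ring atMost_atLeast0 by (simp add: power_divide)
      also have "\<dots> \<le> (\<Sum>p=0..r. real (r choose p) * (1 / d ^ p) * B p \<omega> * real c ^ (r - p))"
        using le_B d by (intro sum_mono mult_right_mono mult_left_mono) auto
      finally show "real (sample_max n N \<omega>) ^ r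
          \<le> (\<Sum>p=0..r. real (r choose p) * (1 / d ^ p) * B p \<omega> * real c ^ (r - p))" .
    qed
  qed (use B_int sample_max_moment_integrable in auto)
  also have "\<dots> = (\<Sum>p=0..r. real (r choose p) * (1 / d ^ p) * u (s p) n c p * real c ^ (r - p))"
    using B_int by (simp add: B_exp)
  finally show ?thesis .
qed

end

section \<open>The coupling, and transfer of moments from it to the sample\<close>

abbreviation "coupling_space n c \<equiv> PiM {1..n::nat} (\<lambda>_. exp_prod c)"

text \<open>For \<open>y \<ge> 0\<close> the ceiling lies between \<open>y\<close> and
  \<open>y + 1\<close>; summing \<open>c\<close> of these gives the additive error
  \<open>c\<close>.\<close>

lemma gamma_sandwich_coupling:
  assumes "n \<ge> 1" "c \<ge> 1" "d > 0"
  shows "gamma_sandwich (coupling_space n c) n c d (\<lambda>j \<omega>. \<Sum>i<c. nat \<lceil>\<omega> j i / d\<rceil>) (\<lambda>j \<omega>. \<Sum>i<c. \<omega> j i)"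
proof -
  have I: "finite {1..n}" "{1..n} \<noteq> {}" using assms by auto
  interpret prob_space "coupling_space n c"
    by (intro prob_space_PiM prob_space_exp_prod)
  note G = indep_vars_PiM_compose[OF I prob_space_exp_prod measurable_exp_sum]
  show ?thesis
  proof unfold_locales
    show "(\<lambda>\<omega>. \<Sum>i<c. nat \<lceil>\<omega> j i / d\<rceil>) \<in> measurable (coupling_space n c) (count_space UNIV)"
      if "j \<in> {1..n}" for j
      by (rule measurable_compose[OF measurable_component_singleton[OF that, of "\<lambda>_. exp_prod c"]
            measurable_ceiling_sum])
    show "indep_vars (\<lambda>_. borel) (\<lambda>j \<omega>. \<Sum>i<c. \<omega> j i) {1..n}"
      by (rule G(1))
    show "distr (coupling_space n c) borel (\<lambda>\<omega>. \<Sum>i<c. \<omega> j i) = gamma_law c" if "j \<in> {1..n}" for j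
      using G(2)[OF that] by (simp add: gamma_law_def)
    have "AE x in unit_exp. 0 \<le> x"
      by (subst AE_density) (auto simp: exponential_density_def)
    then have "AE x in exp_prod c. \<forall>i\<in>{..<c}. 0 \<le> x i"
      by (intro AE_finite_allI AE_PiM_component prob_space_unit_exp) auto
    then have "AE \<omega> in coupling_space n c. \<forall>j\<in>{1..n}. \<forall>i\<in>{..<c}. 0 \<le> \<omega> j i"
      by (intro AE_finite_allI AE_PiM_component[where P="\<lambda>x. \<forall>i\<in>{..<c}. 0 \<le> x i"]
          prob_space_exp_prod) auto
    then show "AE \<omega> in coupling_space n c. \<forall>j\<in>{1..n}. 0 \<le> (\<Sum>i<c. \<omega> j i)
        \<and> (\<Sum>i<c. \<omega> j i) / d \<le> real (\<Sum>i<c. nat \<lceil>\<omega> j i / d\<rceil>)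
        \<and> real (\<Sum>i<c. nat \<lceil>\<omega> j i / d\<rceil>) \<le> (\<Sum>i<c. \<omega> j i) / d + real c"
    proof eventually_elim
      fix \<omega> :: "nat \<Rightarrow> nat \<Rightarrow> real"
      assume \<omega>: "\<forall>j\<in>{1..n}. \<forall>i\<in>{..<c}. 0 \<le> \<omega> j i"
      show "\<forall>j\<in>{1..n}. 0 \<le> (\<Sum>i<c. \<omega> j i)
          \<and> (\<Sum>i<c. \<omega> j i) / d \<le> real (\<Sum>i<c. nat \<lceil>\<omega> j i / d\<rceil>)
          \<and> real (\<Sum>i<c. nat \<lceil>\<omega> j i / d\<rceil>) \<le> (\<Sum>i<c. \<omega> j i) / d + real c"
      proof (intro ballI conjI)
        fix j assume j: "j \<in> {1..n}"
        show "0 \<le> (\<Sum>i<c. \<omega> j i)" using \<omega> j by (intro sum_nonneg) auto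
        show "(\<Sum>i<c. \<omega> j i) / d \<le> real (\<Sum>i<c. nat \<lceil>\<omega> j i / d\<rceil>)"
          unfolding sum_divide_distrib of_nat_sum by (intro sum_mono) linarith
        have "real (nat \<lceil>\<omega> j i / d\<rceil>) \<le> \<omega> j i / d + 1" if "i < c" for i
        proof -
          \<comment> \<open>Nonnegativity matters here: for \<open>y < -1\<close> the truncated
            ceiling \<open>0\<close> would exceed \<open>y + 1\<close>.\<close>
          have "0 \<le> \<omega> j i / d" using \<omega> j that assms by simp
          then show ?thesis by linarith
        qed
        then have "real (\<Sum>i<c. nat \<lceil>\<omega> j i / d\<rceil>) \<le> (\<Sum>i<c. \<omega> j i / d + 1)"
          unfolding of_nat_sum by (intro sum_mono) auto
        then show "real (\<Sum>i<c. nat \<lceil>\<omega> j i / d\<rceil>) \<le> (\<Sum>i<c. \<omega> j i) / d + real c"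
          by (simp add: sum.distrib sum_divide_distrib)
      qed
    qed
  qed (use assms in auto)
qed

text \<open>The moment depends only on the joint law of the sample. By independence and
  \<open>neg_bin_eq_distr\<close> this is the joint law of the sums of ceilings on the coupling
  space.\<close>

lemma (in prob_space) expectation_sample_max_coupling:
  fixes Y :: "nat \<Rightarrow> 'a \<Rightarrow> nat"
  assumes "n \<ge> 1" "c \<ge> 1" "0 < q" "q < 1"
    and Y: "indep_vars (\<lambda>_. count_space UNIV) Y {1..n}"
    and distr_Y: "\<And>j. j \<in> {1..n} \<Longrightarrow> distr M (count_space UNIV) (Y j) = measure_pmf (neg_bin c q)"
  shows "expectation (\<lambda>\<omega>. real (sample_max n Y \<omega>) ^ r)
    = prob_space.expectation (coupling_space n c)
        (\<lambda>\<omega>. real (sample_max n (\<lambda>j \<omega>. \<Sum>i<c. nat \<lceil>\<omega> j i / \<phi> q\<rceil>) \<omega>) ^ r)"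
proof -
  let ?C = "count_space (UNIV :: nat set)"
  define F where "F = (\<lambda>y. real (sample_max n (\<lambda>j y. y j) y) ^ r)"
  have I: "finite {1..n}" "{1..n} \<noteq> {}" using assms by auto
  have Y_meas: "Y j \<in> measurable M ?C" if "j \<in> {1..n}" for j
    using Y that by (auto simp: indep_vars_def)
  have [measurable]: "sample_max n (\<lambda>j y. y j) \<in> measurable (PiM {1..n} (\<lambda>_. ?C)) ?C"
    using assms(1) by (intro sample_max_measurable measurable_component_singleton)
  have F: "F \<in> borel_measurable (PiM {1..n} (\<lambda>_. ?C))"
    unfolding F_def by measurable
  \<comment> \<open>The maximum reads only the coordinates in \<open>{1..n}\<close>, so restricting
    to them leaves it unchanged.\<close>
  have F_restrict: "F (\<lambda>j\<in>{1..n}. Z j \<omega>) = real (sample_max n Z \<omega>) ^ r"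
    for Z :: "nat \<Rightarrow> 'b \<Rightarrow> nat" and \<omega>
    by (simp add: F_def sample_max_def cong: image_cong_simp)
  have "distr M (PiM {1..n} (\<lambda>_. ?C)) (\<lambda>\<omega>. \<lambda>j\<in>{1..n}. Y j \<omega>) = PiM {1..n} (\<lambda>j. distr M ?C (Y j))"
    using Y indep_vars_iff_distr_eq_PiM'[OF I(2) Y_meas] by simp
  also have "\<dots> = PiM {1..n}
      (\<lambda>_. distr (exp_prod c) ?C (\<lambda>x. \<Sum>i<c. nat \<lceil>x i / \<phi> q\<rceil>))"
    using assms by (intro PiM_cong) (simp_all add: distr_Y neg_bin_eq_distr)
  also have "\<dots> = distr (coupling_space n c) (PiM {1..n} (\<lambda>_. ?C))
      (\<lambda>\<omega>. \<lambda>j\<in>{1..n}. \<Sum>i<c. nat \<lceil>\<omega> j i / \<phi> q\<rceil>)"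
    by (rule indep_vars_PiM_compose(3)[OF I prob_space_exp_prod measurable_ceiling_sum, symmetric])
  finally have law: "distr M (PiM {1..n} (\<lambda>_. ?C)) (\<lambda>\<omega>. \<lambda>j\<in>{1..n}. Y j \<omega>)
    = distr (coupling_space n c) (PiM {1..n} (\<lambda>_. ?C))
      (\<lambda>\<omega>. \<lambda>j\<in>{1..n}. \<Sum>i<c. nat \<lceil>\<omega> j i / \<phi> q\<rceil>)" .
  have "expectation (\<lambda>\<omega>. real (sample_max n Y \<omega>) ^ r)
      = (\<integral>y. F y \<partial>distr M (PiM {1..n} (\<lambda>_. ?C)) (\<lambda>\<omega>. \<lambda>j\<in>{1..n}. Y j \<omega>))"
    unfolding F_restrict[of Y, symmetric]
    by (rule integral_distr[symmetric, OF _ F]) (intro measurable_restrict Y_meas)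
  also have "\<dots> = prob_space.expectation (coupling_space n c)
      (\<lambda>\<omega>. F (\<lambda>j\<in>{1..n}. \<Sum>i<c. nat \<lceil>\<omega> j i / \<phi> q\<rceil>))"
    unfolding law
    by (rule integral_distr[OF _ F]) (intro measurable_restrict
        measurable_compose[OF measurable_component_singleton[of _ _ "\<lambda>_. exp_prod c"]
          measurable_ceiling_sum])
  finally show ?thesis
    unfolding F_restrict[of "\<lambda>j \<omega>. \<Sum>i<c. nat \<lceil>\<omega> j i / \<phi> q\<rceil>"] .
qed

text \<open>The first conjunct ties the integral \<open>Q\<close> to the Gamma law. The upper bound
  appears both for a common \<open>s\<close> and for a family \<open>s p\<close>, since the
  minimiser of \<open>u s n c p\<close> depends on \<open>p\<close>. The last conjuncts identify the
  closed form for the mean as the least upper bound obtainable from \<open>s \<ge> 0\<close> at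
  \<open>r = 1\<close>.\<close>

theorem proposition8:
  fixes M :: "'a measure" and Y :: "nat \<Rightarrow> 'a \<Rightarrow> nat" and n c r :: nat and q :: real
  assumes "prob_space M"
    and "n \<ge> 1" and "c \<ge> 1" and "r \<ge> 1" and "0 < q" and "q < 1"
    and "prob_space.indep_vars M (\<lambda>_. count_space UNIV) Y {1..n}"
    and "\<forall>j\<in>{1..n}. distr M (count_space UNIV) (Y j) = measure_pmf (neg_bin c q)"
  shows
    "(\<forall>x\<ge>0. Q c x = measure (gamma_law c) {x<..})
   \<and> (\<forall>t. t \<ge> gamma_moment c r powr (1 / real r) \<longrightarrow>
        prob_space.expectation M (\<lambda>\<omega>. real (sample_max n Y \<omega>) ^ r) \<ge> 1 / \<phi> q ^ r * l t n c r)
   \<and> (\<exists>t\<^sub>0. t\<^sub>0 \<ge> gamma_moment c r powr (1 / real r)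
        \<and> ((\<lambda>t. l t n c r) has_real_derivative 0) (at t\<^sub>0)
        \<and> (\<forall>t. t \<ge> gamma_moment c r powr (1 / real r) \<longrightarrow> l t n c r \<le> l t\<^sub>0 n c r)
        \<and> (n \<ge> 2 \<longrightarrow>
             (\<forall>t. t \<ge> gamma_moment c r powr (1 / real r)
                  \<and> ((\<lambda>t. l t n c r) has_real_derivative 0) (at t) \<longrightarrow> t = t\<^sub>0)))
   \<and> (\<forall>s\<ge>0. prob_space.expectation M (\<lambda>\<omega>. real (sample_max n Y \<omega>) ^ r)
        \<le> (\<Sum>p=0..r. real (r choose p) * (1 / \<phi> q ^ p) * u s n c p * real c ^ (r - p)))
   \<and> (\<forall>s. (\<forall>p. s p \<ge> 0) \<longrightarrow>
        prob_space.expectation M (\<lambda>\<omega>. real (sample_max n Y \<omega>) ^ r)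
        \<le> (\<Sum>p=0..r. real (r choose p) * (1 / \<phi> q ^ p) * u (s p) n c p * real c ^ (r - p)))
   \<and> (\<forall>p\<in>{1..r}.
        (\<exists>s\<ge>0. real n * Q c (s powr (1 / real p)) = 1)
        \<and> (\<forall>s\<ge>0. real n * Q c (s powr (1 / real p)) = 1
                 \<longleftrightarrow> (\<forall>s'\<ge>0. u s n c p \<le> u s' n c p)))
   \<and> prob_space.expectation M (\<lambda>\<omega>. real (sample_max n Y \<omega>))
        \<le> real c * (1 + 1 / \<phi> q * real n * Q (c + 1) (Q_inv c (1 / real n)))
   \<and> Q_inv c (1 / real n) \<ge> 0 \<and> real n * Q c (Q_inv c (1 / real n)) = 1
   \<and> real c * (1 + 1 / \<phi> q * real n * Q (c + 1) (Q_inv c (1 / real n)))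
        = (\<Sum>p=0..1. real (1 choose p) * (1 / \<phi> q ^ p) * u (Q_inv c (1 / real n)) n c p
             * real c ^ (1 - p))
   \<and> (\<forall>s\<ge>0. real c * (1 + 1 / \<phi> q * real n * Q (c + 1) (Q_inv c (1 / real n)))
        \<le> (\<Sum>p=0..1. real (1 choose p) * (1 / \<phi> q ^ p) * u s n c p * real c ^ (1 - p)))"
proof -
  interpret prob_space M by (rule assms(1))
  note n = assms(2) and c = assms(3) and r = assms(4)
  have \<phi>: "\<phi> q > 0" using assms(5,6) by (simp add: \<phi>_def)
  interpret S: gamma_sandwich "coupling_space n c" n c "\<phi> q"
    "\<lambda>j \<omega>. \<Sum>i<c. nat \<lceil>\<omega> j i / \<phi> q\<rceil>" "\<lambda>j \<omega>. \<Sum>i<c. \<omega> j i"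
    using n c \<phi> by (rule gamma_sandwich_coupling)
  have coupling: "expectation (\<lambda>\<omega>. real (sample_max n Y \<omega>) ^ m)
      = S.expectation (\<lambda>\<omega>. real (sample_max n (\<lambda>j \<omega>. \<Sum>i<c. nat \<lceil>\<omega> j i / \<phi> q\<rceil>) \<omega>) ^ m)" for m
    using n c assms(5-8) by (intro expectation_sample_max_coupling) auto
  have upper: "expectation (\<lambda>\<omega>. real (sample_max n Y \<omega>) ^ m)
      \<le> (\<Sum>p=0..m. real (m choose p) * (1 / \<phi> q ^ p) * u (s p) n c p * real c ^ (m - p))"
    if "\<forall>p. s p \<ge> 0" for m s
    unfolding coupling using that by (intro S.sample_max_moment_le) auto
  define a where "a = Q_inv c (1 / real n)"
  have a: "a \<ge> 0" "real n * Q c a = 1"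
    using Q_Q_inv[OF n c] by (auto simp: a_def)
  have u_a: "u a n c 1 = real c * real n * Q (c + 1) a"
    using u_1_optimal[OF c a] .
  have sum_1: "(\<Sum>p=0..1. real (1 choose p) * (1 / \<phi> q ^ p) * u s n c p * real c ^ (1 - p))
      = real c + 1 / \<phi> q * u s n c 1" for s
    by (simp add: u_def[of s n c 0])
  have opt: "real c * (1 + 1 / \<phi> q * real n * Q (c + 1) a)
      = (\<Sum>p=0..1. real (1 choose p) * (1 / \<phi> q ^ p) * u a n c p * real c ^ (1 - p))"
    unfolding sum_1 u_a by (simp add: algebra_simps)

  have "\<forall>x\<ge>0. Q c x = measure (gamma_law c) {x<..}"
    using c measure_erlang_greaterThan[of _ "c - 1"]
    by (simp add: Q_eq_gamma_tail gamma_law_eq_erlang)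
  moreover have "\<forall>t. t \<ge> gamma_moment c r powr (1 / real r) \<longrightarrow>
      expectation (\<lambda>\<omega>. real (sample_max n Y \<omega>) ^ r) \<ge> 1 / \<phi> q ^ r * l t n c r"
    unfolding coupling
  proof (intro allI impI S.sample_max_moment_ge)
    fix t assume "t \<ge> gamma_moment c r powr (1 / real r)"
    then show "t \<ge> 0" using powr_ge_zero order_trans by blast
  qed
  moreover note l_stationary[OF n c r gamma_moment_pos[OF c]]
  moreover have "\<forall>s\<ge>0. expectation (\<lambda>\<omega>. real (sample_max n Y \<omega>) ^ r)
      \<le> (\<Sum>p=0..r. real (r choose p) * (1 / \<phi> q ^ p) * u s n c p * real c ^ (r - p))"
    by (intro allI impI upper) simp
  moreover have "\<forall>s. (\<forall>p. s p \<ge> 0) \<longrightarrow> expectation (\<lambda>\<omega>. real (sample_max n Y \<omega>) ^ r)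
      \<le> (\<Sum>p=0..r. real (r choose p) * (1 / \<phi> q ^ p) * u (s p) n c p * real c ^ (r - p))"
    by (intro allI impI upper) simp
  moreover have "\<forall>p\<in>{1..r}.
        (\<exists>s\<ge>0. real n * Q c (s powr (1 / real p)) = 1)
        \<and> (\<forall>s\<ge>0. real n * Q c (s powr (1 / real p)) = 1
                 \<longleftrightarrow> (\<forall>s'\<ge>0. u s n c p \<le> u s' n c p))"
  proof (intro ballI conjI)
    fix p assume "p \<in> {1..r}"
    then have p: "p \<ge> 1" by simp
    show "\<forall>s\<ge>0. real n * Q c (s powr (1 / real p)) = 1 \<longleftrightarrow> (\<forall>s'\<ge>0. u s n c p \<le> u s' n c p)"
      using u_minimal_iff[OF n c p] by blast
    \<comment> \<open>The optimal levels for all \<open>p\<close> are the powers of the single root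
      \<open>a\<close>.\<close>
    have "(a powr real p) powr (1 / real p) = a"
      using p a(1) by (simp add: powr_powr)
    then show "\<exists>s\<ge>0. real n * Q c (s powr (1 / real p)) = 1"
      using a(2) by (intro exI[of _ "a powr real p"]) simp
  qed
  moreover have "expectation (\<lambda>\<omega>. real (sample_max n Y \<omega>))
      \<le> real c * (1 + 1 / \<phi> q * real n * Q (c + 1) a)"
    using upper[of "\<lambda>_. a" 1] a(1) unfolding opt by simp
  moreover have "\<forall>s\<ge>0. real c * (1 + 1 / \<phi> q * real n * Q (c + 1) a)
      \<le> (\<Sum>p=0..1. real (1 choose p) * (1 / \<phi> q ^ p) * u s n c p * real c ^ (1 - p))"
  proof (intro allI impI)
    fix s :: real assume s: "s \<ge> 0"
    have "u a n c 1 \<le> u s n c 1"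
      using u_minimal_iff[OF n c order.refl a(1)] a s by simp
    then show "real c * (1 + 1 / \<phi> q * real n * Q (c + 1) a)
        \<le> (\<Sum>p=0..1. real (1 choose p) * (1 / \<phi> q ^ p) * u s n c p * real c ^ (1 - p))"
      unfolding opt sum_1 using \<phi> by (simp add: divide_right_mono)
  qed
  ultimately show ?thesis
    using a opt unfolding a_def[symmetric] by (intro conjI)
qed

end
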